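(* Let $a,b,c,x_0,x_1,x_2\in\mathbb{Z}$ and let $(x_n)_{n\in\mathbb{Z}}$ satisfy $x_n=ax_{n-1}+bx_{n-2}+cx_{n-3}$ for all $n\in\mathbb{Z}$, and assume $x_n=\sum_{i=1}^3 c_{\lambda_i}\lambda_i^n$ for all $n\in\mathbb{Z}$, where $c_{\lambda_i}=q(\lambda_i)/P'(\lambda_i)$, $P(x)=x^3-ax^2-bx-c$, $q(x)=x_0x^2+(x_1-x_0a)x+(x_2-x_1a-x_0b)$, and $\lambda_1,\lambda_2,\lambda_3\in\mathbb{C}$ are the roots of $P$. Suppose that $P$ is irreducible over $\mathbb{Q}$ and that the following three conditions hold: \begin{enumerate} \item $\mathbb{Q}(\lambda_i)$ is not a Galois extension of $\mathbb{Q}$ for some $1\le i\le 3$; \item for this $i$ and some $1\le j\le 3$, $j\ne i$, $$\log\left|\frac{q(\lambda_i)P'(\lambda_j)}{q(\lambda_j)P'(\lambda_i)}\right|\Big/\log\left|\frac{\lambda_j}{\lambda_i}\right|\notin\mathbb{Z};$$ \item $\mathbb{Q}(\lambda_1,\lambda_2,\lambda_3)$ does not contain primitive cubic roots of unity. \end{enumerate} Then the set of twisted integral zeros of $(x_n)$ equals the set of zeros of $(x_n)$.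
   Context: An integer $n$ is a zero of $(x_n)$ if $\sum_{i=1}^3 c_{\lambda_i}\lambda_i^n=0$. An integer $n$ is a twisted integral zero of $(x_n)$ if $\sum_{i=1}^3\xi_i c_{\lambda_i}\lambda_i^n=0$ for some roots of unity $\xi_1,\xi_2,\xi_3$. *)

theory Defs
  imports "HOL-Analysis.Analysis" "HOL-Algebra.Generated_Fields"
    "HOL-Algebra.Algebraic_Closure_Type"
begin

abbreviation complex_field :: "complex ring" where
  "complex_field \<equiv> ring_of_type_algebra"

text \<open>A generated subfield always contains the prime field, so this is \<open>\<rat>(S)\<close>.\<close>

definition rat_adjoin :: "complex set \<Rightarrow> complex set" where
  "rat_adjoin S = generate_field complex_field S"

lemma subfield_rat_adjoin: "subfield (rat_adjoin S) complex_field"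
proof -
  interpret C: field complex_field by (rule field_from_type_algebra)
  show ?thesis unfolding rat_adjoin_def
    by (rule C.generate_field_is_subfield) (simp add: ring_of_type_algebra_def)
qed

lemma complex_field_a_inv: "a_inv complex_field x = - x"
proof -
  interpret C: field complex_field by (rule field_from_type_algebra)
  show ?thesis
    by (rule C.minus_equality) (simp_all add: ring_of_type_algebra_def)
qed

lemma complex_field_m_inv: "x \<noteq> 0 \<Longrightarrow> m_inv complex_field x = inverse x"
proof -
  assume "x \<noteq> 0"
  interpret C: field complex_field by (rule field_from_type_algebra)
  show ?thesis
    by (rule C.comm_inv_char) (use \<open>x \<noteq> 0\<close> in \<open>simp_all add: ring_of_type_algebra_def\<close>)
qed

lemma rat_adjoin_empty: "rat_adjoin {} = \<rat>"
proof
  have "z \<in> \<rat>" if "z \<in> generate_field complex_field {}" for z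
    using that
  proof induction
    case (m_inv h)
    then have "h \<noteq> 0" by (simp add: ring_of_type_algebra_def)
    with m_inv show ?case by (simp add: complex_field_m_inv)
  qed (simp_all add: complex_field_a_inv, simp_all add: ring_of_type_algebra_def)
  then show "rat_adjoin {} \<subseteq> \<rat>" by (auto simp: rat_adjoin_def)
next
  let ?G = "generate_field complex_field {}"
  have one: "1 \<in> ?G"
    using generate_field.one[of complex_field "{}"] by (simp add: ring_of_type_algebra_def)
  have neg: "- z \<in> ?G" if "z \<in> ?G" for z
    using generate_field.a_inv[OF that] by (simp add: complex_field_a_inv)
  have add: "z + w \<in> ?G" if "z \<in> ?G" "w \<in> ?G" for z w
    using generate_field.eng_add[OF that] by (simp add: ring_of_type_algebra_def)
  have mult: "z * w \<in> ?G" if "z \<in> ?G" "w \<in> ?G" for z w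
    using generate_field.eng_mult[OF that] by (simp add: ring_of_type_algebra_def)
  have zero: "0 \<in> ?G" using add[OF one neg[OF one]] by simp
  have inv: "inverse z \<in> ?G" if "z \<in> ?G" for z
  proof (cases "z = 0")
    case False
    then have "z \<noteq> ring.zero complex_field" by (simp add: ring_of_type_algebra_def)
    from generate_field.m_inv[OF that this] False show ?thesis
      by (simp add: complex_field_m_inv)
  qed (simp add: zero)
  have nat: "of_nat n \<in> ?G" for n
    by (induction n) (simp_all add: zero one add)
  have int: "of_int k \<in> ?G" for k
  proof (cases k)
    case (nonneg n) then show ?thesis using nat[of n] by simp
  next
    case (neg n) then show ?thesis using \<open>\<And>z. z \<in> ?G \<Longrightarrow> - z \<in> ?G\<close>[OF nat[of "Suc n"]] by simp
  qed
  show "\<rat> \<subseteq> rat_adjoin {}"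
  proof
    fix z :: complex assume "z \<in> \<rat>"
    then obtain p r where "z = of_int p / of_int r" by (rule Rats_cases')
    then show "z \<in> rat_adjoin {}"
      using mult[OF int[of p] inv[OF int[of r]]] by (simp add: rat_adjoin_def field_class.field_divide_inverse)
  qed
qed

lemma subfield_Rats: "subfield \<rat> complex_field"
  using subfield_rat_adjoin[of "{}"] by (simp add: rat_adjoin_empty)

definition field_auts ::
    "('a, 'b) ring_scheme \<Rightarrow> 'a set \<Rightarrow> 'a set \<Rightarrow> ('a \<Rightarrow> 'a) set" where
  "field_auts R F K =
     {\<sigma> \<in> ring_iso (R\<lparr>carrier := K\<rparr>) (R\<lparr>carrier := K\<rparr>). \<forall>x\<in>F. \<sigma> x = x}"

text \<open>For subfields \<open>F\<close>, \<open>K\<close> of an ambient field \<open>R\<close>: the extension \<open>K / F\<close> is Galois if it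
  is algebraic and \<open>F\<close> is the fixed field of \<open>Aut(K / F)\<close>.\<close>

definition galois_extension :: "('a, 'b) ring_scheme \<Rightarrow> 'a set \<Rightarrow> 'a set \<Rightarrow> bool" where
  "galois_extension R F K \<longleftrightarrow>
     subfield F R \<and> subfield K R \<and> F \<subseteq> K \<and>
     (\<forall>x\<in>K. \<not> ring.transcendental R F x) \<and>
     {x \<in> K. \<forall>\<sigma>\<in>field_auts R F K. \<sigma> x = x} = F"

definition root_of_unity :: "complex \<Rightarrow> bool" where
  "root_of_unity \<xi> \<longleftrightarrow> (\<exists>m::nat. m > 0 \<and> \<xi> ^ m = 1)"

definition primitive_root_of_unity :: "nat \<Rightarrow> complex \<Rightarrow> bool" where
  "primitive_root_of_unity m \<xi> \<longleftrightarrow>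
     m > 0 \<and> \<xi> ^ m = 1 \<and> (\<forall>k. 0 < k \<and> k < m \<longrightarrow> \<xi> ^ k \<noteq> 1)"

definition rec_P :: "int \<Rightarrow> int \<Rightarrow> int \<Rightarrow> int poly" where
  "rec_P a b c = [:- c, - b, - a, 1:]"

definition rec_q :: "int \<Rightarrow> int \<Rightarrow> int \<Rightarrow> int \<Rightarrow> int \<Rightarrow> int poly" where
  "rec_q a b x0 x1 x2 = [:x2 - x1 * a - x0 * b, x1 - x0 * a, x0:]"

definition integral_zeros :: "(nat \<Rightarrow> complex) \<Rightarrow> (nat \<Rightarrow> complex) \<Rightarrow> int set" where
  "integral_zeros C lam = {n. (\<Sum>i=1..3. C i * lam i powi n) = 0}"

definition twisted_integral_zeros ::
    "(nat \<Rightarrow> complex) \<Rightarrow> (nat \<Rightarrow> complex) \<Rightarrow> int set" where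
  "twisted_integral_zeros C lam =
     {n. \<exists>\<xi>. (\<forall>i\<in>{1..3}. root_of_unity (\<xi> i)) \<and>
             (\<Sum>i=1..3. \<xi> i * C i * lam i powi n) = 0}"

end

theory Submission
  imports Defs
begin

text \<open>
  Fix \<open>n\<close> and put \<open>\<alpha>\<^sub>k = C\<^sub>k \<lambda>\<^sub>k ^ n = f(\<lambda>\<^sub>k)\<close> with \<open>f \<in> \<rat>[x]\<close>. Let
  \<open>\<delta> = (\<lambda>\<^sub>1 - \<lambda>\<^sub>2)(\<lambda>\<^sub>2 - \<lambda>\<^sub>3)(\<lambda>\<^sub>3 - \<lambda>\<^sub>1)\<close>; it is irrational, since otherwise
  \<open>\<rat>(\<lambda>\<^sub>i)\<close> would be Galois. Hence no \<open>\<lambda>\<^sub>k\<close> lies in a cyclotomic field \<open>F\<close> (which is abelian), nor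
  in its quadratic extension \<open>E = F(\<delta>)\<close>, so the 3-cycle acts on the roots over \<open>E\<close>. A relation
  \<open>\<xi>\<^sub>1 \<alpha>\<^sub>1 + \<xi>\<^sub>2 \<alpha>\<^sub>2 + \<xi>\<^sub>3 \<alpha>\<^sub>3 = 0\<close> with roots of unity \<open>\<xi>\<^sub>k\<close> may therefore be rotated, and the
  circulant determinant
  \<open>(\<alpha>\<^sub>1 + \<alpha>\<^sub>2 + \<alpha>\<^sub>3)(\<alpha>\<^sub>1 + \<omega> \<alpha>\<^sub>2 + \<omega>\<^sup>2 \<alpha>\<^sub>3)(\<alpha>\<^sub>1 + \<omega>\<^sup>2 \<alpha>\<^sub>2 + \<omega> \<alpha>\<^sub>3)\<close>
  vanishes. As \<open>\<omega>\<close> is not in the splitting field, a zero of the last two factors forces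
  \<open>\<alpha>\<^sub>1 = \<alpha>\<^sub>2 = \<alpha>\<^sub>3\<close>, which the condition on logarithms excludes.
\<close>

section \<open>Rational polynomials evaluated at complex numbers\<close>

text \<open>Elements of the field \<rat>(z) are represented by rational polynomials, so that a
  conjugation is the substitution of another root of the same irreducible polynomial for z.\<close>

definition rat_eval :: "rat poly \<Rightarrow> complex \<Rightarrow> complex" where
  "rat_eval h z = poly (map_poly of_rat h) z"

lemma rat_eval_0 [simp]: "rat_eval 0 z = 0"
  and rat_eval_pCons [simp]: "rat_eval (pCons a h) z = of_rat a + z * rat_eval h z"
  by (simp_all add: rat_eval_def map_poly_pCons)

lemma rat_eval_1 [simp]: "rat_eval 1 z = 1"
  by (simp add: one_pCons)

lemma rat_eval_add [simp]: "rat_eval (g + h) z = rat_eval g z + rat_eval h z"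
proof (induction g arbitrary: h)
  case (pCons a g)
  show ?case
    by (cases h) (simp add: pCons.IH of_rat_add distrib_left)
qed simp

lemma rat_eval_uminus [simp]: "rat_eval (- h) z = - rat_eval h z"
  by (induction h) (simp_all add: of_rat_minus)

lemma rat_eval_diff [simp]: "rat_eval (g - h) z = rat_eval g z - rat_eval h z"
  using rat_eval_add[of g "- h"] by simp

lemma rat_eval_smult [simp]: "rat_eval (Polynomial.smult r h) z = of_rat r * rat_eval h z"
  by (induction h) (simp_all add: of_rat_mult algebra_simps)

lemma rat_eval_mult [simp]: "rat_eval (g * h) z = rat_eval g z * rat_eval h z"
  by (induction g) (simp_all add: algebra_simps)

lemma rat_eval_power [simp]: "rat_eval (h ^ n) z = rat_eval h z ^ n"
  by (induction n) simp_all

lemma rat_eval_pcompose [simp]: "rat_eval (pcompose g h) z = rat_eval g (rat_eval h z)"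
  by (induction g) (simp_all add: pcompose_pCons)

lemma rat_eval_prod_mset: "rat_eval (\<Prod>\<^sub># A) z = (\<Prod>h\<in>#A. rat_eval h z)"
  by (induction A) simp_all

text \<open>Supplies a minimal polynomial up to a unit; for a root of unity it avoids constructing
  cyclotomic polynomials.\<close>

lemma irreducible_factor_vanishing:
  assumes "h \<noteq> 0" "rat_eval h z = 0"
  obtains m where "Factorial_Ring.irreducible m" "m dvd h" "rat_eval m z = 0"
proof -
  have "h dvd \<Prod>\<^sub># (prime_factorization h)"
    using prod_mset_prime_factorization_weak[OF assms(1)]
    by (metis associated_iff_dvd)
  then obtain k where "\<Prod>\<^sub># (prime_factorization h) = h * k" by blast
  then have "rat_eval (\<Prod>\<^sub># (prime_factorization h)) z = 0"
    by (simp add: assms(2))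
  then have "0 \<in># {#rat_eval m z. m \<in># prime_factorization h#}"
    by (simp add: rat_eval_prod_mset prod_mset_zero_iff)
  then obtain m where "m \<in># prime_factorization h" "rat_eval m z = 0"
    by auto
  with that show ?thesis
    by (metis in_prime_factors_iff prime_elem_imp_irreducible prime_imp_prime_elem)
qed

text \<open>The Bezout coefficient of \<open>h\<close> inverts \<open>h\<close> at all roots of
  \<open>m\<close> simultaneously. This uniformity lets one polynomial represent the reciprocals of
  all conjugates.\<close>

lemma irreducible_bezout:
  fixes m h :: "rat poly"
  assumes "Factorial_Ring.irreducible m" "\<not> m dvd h"
  obtains s where "\<And>z. rat_eval m z = 0 \<Longrightarrow> rat_eval s z * rat_eval h z = 1"
proof -
  have "Rings.coprime m h"
    using assms by (simp add: prime_elem_imp_coprime irreducible_imp_prime_elem)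
  then obtain t s where ts: "t * m + s * h = 1"
    by (metis bezout_coefficients coprime_iff_gcd_eq_1 surj_pair)
  show ?thesis
  proof
    fix z assume "rat_eval m z = 0"
    moreover have "rat_eval (t * m + s * h) z = 1"
      by (subst ts) simp
    ultimately show "rat_eval s z * rat_eval h z = 1" by simp
  qed
qed

section \<open>Conjugation between the roots of an irreducible polynomial\<close>

lemma irreducible_dvd_iff:
  assumes "Factorial_Ring.irreducible m" "rat_eval m z = 0"
  shows "m dvd h \<longleftrightarrow> rat_eval h z = 0"
proof
  assume "m dvd h"
  then show "rat_eval h z = 0" using assms(2) by auto
next
  assume h: "rat_eval h z = 0"
  show "m dvd h"
    using irreducible_bezout[OF assms(1), of h] assms(2) h
    by (metis mult_zero_right zero_neq_one)
qed

lemma conjugate_vanishing: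
  assumes "Factorial_Ring.irreducible m" "rat_eval m z = 0" "rat_eval m w = 0" "rat_eval h z = 0"
  shows "rat_eval h w = 0"
  using irreducible_dvd_iff assms by blast

text \<open>This makes the embedding of \<rat>(z) that sends z to w well defined; exchanging z and w
  gives its injectivity.\<close>

lemma conjugate_eq:
  assumes "Factorial_Ring.irreducible m" "rat_eval m z = 0" "rat_eval m w = 0"
    and "rat_eval g z = rat_eval h z"
  shows "rat_eval g w = rat_eval h w"
  using conjugate_vanishing[OF assms(1-3), of "g - h"] assms(4) by simp

lemma degree_map_of_rat: "Polynomial.degree (map_poly of_rat h :: complex poly) = Polynomial.degree h"
  by (rule degree_map_poly) simp

lemma irreducible_degree_pos:
  assumes "Factorial_Ring.irreducible (m :: rat poly)"
  shows "Polynomial.degree m > 0"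
proof (rule ccontr)
  assume "\<not> Polynomial.degree m > 0"
  moreover have "m \<noteq> 0" using assms by auto
  ultimately have "is_unit m" by (simp add: is_unit_iff_degree)
  with assms show False by (simp add: irreducible_not_unit)
qed

text \<open>Separability in characteristic 0: the derivative is nonzero of smaller degree, so
  \<open>m\<close> does not divide it, and the Bezout identity excludes a common root.\<close>

lemma irreducible_card_roots:
  assumes "Factorial_Ring.irreducible m"
  shows "card {z. rat_eval m z = 0} = Polynomial.degree m"
proof -
  let ?M = "map_poly of_rat m :: complex poly"
  have m0: "m \<noteq> 0" using assms by auto
  have "\<not> m dvd pderiv m"
    using irreducible_degree_pos[OF assms]
    by (metis degree_pderiv diff_less dvd_imp_degree_le linorder_not_less pderiv_eq_0_iff
        zero_less_one less_numeral_extra(3))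
  then obtain s where s: "\<And>z. rat_eval m z = 0 \<Longrightarrow> rat_eval s z * rat_eval (pderiv m) z = 1"
    using irreducible_bezout[OF assms] by metis
  have pd: "pderiv ?M = map_poly of_rat (pderiv m)"
    by (rule poly_eqI) (simp add: coeff_pderiv coeff_map_poly of_rat_mult of_rat_add)
  have "rsquarefree ?M"
    unfolding rsquarefree_roots pd rat_eval_def[symmetric]
    using s by (metis mult_zero_right zero_neq_one)
  then have dec: "Polynomial.smult (Polynomial.lead_coeff ?M) (\<Prod>z|poly ?M z = 0. [:-z, 1:]) = ?M"
    by (rule complex_poly_decompose_rsquarefree)
  have "?M \<noteq> 0" using m0 by (simp add: map_poly_eq_0_iff)
  then have "Polynomial.degree ?M = Polynomial.degree (\<Prod>z|poly ?M z = 0. [:-z, 1:])"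
    by (metis dec degree_smult_eq leading_coeff_0_iff)
  also have "\<dots> = (\<Sum>z|poly ?M z = 0. Polynomial.degree [:-z, 1:])"
    by (intro degree_prod_eq_sum_degree) auto
  finally show ?thesis by (simp add: degree_map_of_rat rat_eval_def)
qed

text \<open>The fixed field of all conjugations is \<open>\<rat>\<close>: reducing \<open>h\<close> modulo \<open>m\<close> leaves a polynomial
  that takes the value \<open>y\<close> more often than its degree allows, unless it is constant.\<close>

lemma conjugation_invariant_rational:
  assumes "Factorial_Ring.irreducible m" and inv: "\<And>z. rat_eval m z = 0 \<Longrightarrow> rat_eval h z = y"
  shows "y \<in> \<rat>"
proof -
  define r where "r = h mod m"
  let ?R = "map_poly of_rat r - [:y:] :: complex poly"
  have m0: "m \<noteq> 0" using assms by auto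
  have h: "h = h div m * m + r" by (simp add: r_def)
  have sub: "{z. rat_eval m z = 0} \<subseteq> {z. poly ?R z = 0}"
  proof safe
    fix z assume z: "rat_eval m z = 0"
    have "rat_eval h z = rat_eval r z" by (subst h) (simp add: z)
    with inv[OF z] show "poly ?R z = 0" by (simp add: rat_eval_def)
  qed
  have deg: "Polynomial.degree ?R < Polynomial.degree m"
  proof (rule degree_diff_less)
    show "Polynomial.degree (map_poly of_rat r :: complex poly) < Polynomial.degree m"
      using degree_mod_less'[OF m0, of h] irreducible_degree_pos[OF assms(1)]
      by (cases "r = 0") (auto simp: degree_map_of_rat r_def)
  qed (use irreducible_degree_pos[OF assms(1)] in simp)
  have "?R = 0"
  proof (rule ccontr)
    assume R: "?R \<noteq> 0"
    then have "card {z. rat_eval m z = 0} \<le> card {z. poly ?R z = 0}"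
      using sub poly_roots_finite card_mono by blast
    also have "\<dots> \<le> Polynomial.degree ?R" using R by (rule card_poly_roots_bound)
    finally show False using deg irreducible_card_roots[OF assms(1)] by simp
  qed
  then have "Polynomial.coeff (map_poly of_rat r) 0 = y" by (metis coeff_pCons_0 eq_iff_diff_eq_0)
  then show ?thesis by (auto simp: coeff_map_poly)
qed

section \<open>Subfields of the complex numbers\<close>

text \<open>The closure conditions use the operations of the type \<open>complex\<close>, so that
  computations need no translation from the record \<open>complex_field\<close>.\<close>

locale complex_subfield =
  fixes E :: "complex set"
  assumes one: "1 \<in> E"
    and add: "x \<in> E \<Longrightarrow> y \<in> E \<Longrightarrow> x + y \<in> E"
    and uminus: "x \<in> E \<Longrightarrow> - x \<in> E"
    and mult: "x \<in> E \<Longrightarrow> y \<in> E \<Longrightarrow> x * y \<in> E"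
    and inverse: "x \<in> E \<Longrightarrow> inverse x \<in> E"
begin

lemma diff: "x \<in> E \<Longrightarrow> y \<in> E \<Longrightarrow> x - y \<in> E"
  using add[of x "- y"] uminus by simp

lemma zero: "0 \<in> E"
  using diff[OF one one] by simp

lemma divide: "x \<in> E \<Longrightarrow> y \<in> E \<Longrightarrow> x / y \<in> E"
  by (simp add: divide_inverse mult inverse)

lemma of_nat: "of_nat n \<in> E"
  by (induction n) (simp_all add: zero one add)

lemma of_int: "of_int k \<in> E"
  by (cases k rule: int_cases2) (simp_all add: of_nat uminus)

lemma Rats: "x \<in> \<rat> \<Longrightarrow> x \<in> E"
  by (metis Rats_cases' of_int divide)

lemma of_rat: "of_rat r \<in> E"
  by (rule Rats) simp

lemma rat_eval: "z \<in> E \<Longrightarrow> rat_eval h z \<in> E"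
  by (induction h) (simp_all add: zero add mult of_rat)

lemmas closed = one zero add uminus diff mult inverse divide of_rat

end

lemma complex_subfield_rat_adjoin: "complex_subfield (rat_adjoin S)"
proof
  show "1 \<in> rat_adjoin S"
    using generate_field.one[of complex_field S]
    by (simp add: rat_adjoin_def ring_of_type_algebra_def)
next
  fix x y assume "x \<in> rat_adjoin S" "y \<in> rat_adjoin S"
  then show "x + y \<in> rat_adjoin S" "x * y \<in> rat_adjoin S"
    using generate_field.eng_add[of x complex_field S y] generate_field.eng_mult[of x complex_field S y]
    by (simp_all add: rat_adjoin_def ring_of_type_algebra_def)
next
  fix x assume "x \<in> rat_adjoin S"
  then show neg: "- x \<in> rat_adjoin S"
    using generate_field.a_inv[of x complex_field S]
    by (simp add: rat_adjoin_def complex_field_a_inv)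
next
  fix x assume x: "x \<in> rat_adjoin S"
  show "inverse x \<in> rat_adjoin S"
  proof (cases "x = 0")
    case False
    then have "x \<noteq> ring.zero complex_field" by (simp add: ring_of_type_algebra_def)
    with x False show ?thesis
      using generate_field.m_inv[of x complex_field S]
      by (simp add: rat_adjoin_def complex_field_m_inv)
  qed (use x in simp)
qed

lemma rat_adjoin_incl: "S \<subseteq> rat_adjoin S"
  by (auto simp: rat_adjoin_def intro: generate_field.incl)

lemma rat_adjoin_minimal:
  assumes "complex_subfield E" "S \<subseteq> E"
  shows "rat_adjoin S \<subseteq> E"
proof
  interpret complex_subfield E by fact
  fix x assume "x \<in> rat_adjoin S"
  then have "x \<in> generate_field complex_field S" by (simp add: rat_adjoin_def)
  then show "x \<in> E"
  proof induction
    case (m_inv h)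
    then have "h \<noteq> 0" by (simp add: ring_of_type_algebra_def)
    with m_inv show ?case by (simp add: complex_field_m_inv inverse)
  next
    case (a_inv h)
    then show ?case by (simp add: complex_field_a_inv uminus)
  next
    case (incl h)
    then show ?case using assms(2) by auto
  qed (use one add mult in \<open>simp_all add: ring_of_type_algebra_def\<close>)
qed

lemma complex_subfield_range_rat_eval:
  assumes "Factorial_Ring.irreducible m" "rat_eval m z = 0"
  shows "complex_subfield (range (\<lambda>h. rat_eval h z))"
proof
  show "1 \<in> range (\<lambda>h. rat_eval h z)" by (metis rangeI rat_eval_1)
next
  fix x y assume "x \<in> range (\<lambda>h. rat_eval h z)" "y \<in> range (\<lambda>h. rat_eval h z)"
  then show "x + y \<in> range (\<lambda>h. rat_eval h z)" "x * y \<in> range (\<lambda>h. rat_eval h z)"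
    by (auto simp flip: rat_eval_add rat_eval_mult)
next
  fix x assume "x \<in> range (\<lambda>h. rat_eval h z)"
  then show "- x \<in> range (\<lambda>h. rat_eval h z)"
    by (auto simp flip: rat_eval_uminus)
next
  fix x assume "x \<in> range (\<lambda>h. rat_eval h z)"
  then obtain h where h: "x = rat_eval h z" by auto
  show "inverse x \<in> range (\<lambda>h. rat_eval h z)"
  proof (cases "x = 0")
    case True
    then show ?thesis by (auto intro!: exI[of _ 0] image_eqI[of _ _ 0])
  next
    case False
    then obtain s where "rat_eval s z * rat_eval h z = 1"
      using irreducible_bezout[OF assms(1), of h] irreducible_dvd_iff[OF assms, of h] h assms(2)
      by metis
    then have "inverse x = rat_eval s z" by (simp add: h inverse_unique mult.commute)
    then show ?thesis by auto
  qed
qed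

lemma rat_adjoin_algebraic:
  assumes "Factorial_Ring.irreducible m" "rat_eval m z = 0"
  shows "rat_adjoin {z} = range (\<lambda>h. rat_eval h z)"
proof
  have "z = rat_eval [:0, 1:] z" by simp
  then show "rat_adjoin {z} \<subseteq> range (\<lambda>h. rat_eval h z)"
    by (intro rat_adjoin_minimal complex_subfield_range_rat_eval[OF assms]) blast
  show "range (\<lambda>h. rat_eval h z) \<subseteq> rat_adjoin {z}"
    using rat_adjoin_incl[of "{z}"]
    by (auto intro!: complex_subfield.rat_eval complex_subfield_rat_adjoin)
qed

text \<open>Inverses come from rationalizing the denominator. The case of \<open>d\<close> in
  \<open>F\<close> is treated apart, because there \<open>u - v * d\<close> can vanish although
  \<open>u + v * d\<close> does not.\<close>

lemma complex_subfield_adjoin_sqrt: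
  assumes "complex_subfield F" "d * d \<in> F"
  shows "complex_subfield {u + v * d |u v. u \<in> F \<and> v \<in> F}"
proof -
  interpret F: complex_subfield F by fact
  show ?thesis
  proof (cases "d \<in> F")
    case True
    then have "u + v * d \<in> F" if "u \<in> F" "v \<in> F" for u v
      using that by (simp add: F.add F.mult)
    moreover have "\<exists>u' v. u = u' + v * d \<and> u' \<in> F \<and> v \<in> F" if "u \<in> F" for u
      using that F.zero by (intro exI[of _ u] exI[of _ 0]) simp
    ultimately have "{u + v * d |u v. u \<in> F \<and> v \<in> F} = F"
      by auto
    then show ?thesis by (simp add: assms)
  next
    case False
    let ?E = "{u + v * d |u v. u \<in> F \<and> v \<in> F}"
    have E: "u + v * d \<in> ?E" if "u \<in> F" "v \<in> F" for u v using that by blast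
    show ?thesis
    proof
      show "1 \<in> ?E" using E[OF F.one F.zero] by simp
    next
      fix x y assume "x \<in> ?E" "y \<in> ?E"
      then obtain u v u' v' where x: "x = u + v * d" and y: "y = u' + v' * d"
        and uv: "u \<in> F" "v \<in> F" "u' \<in> F" "v' \<in> F" by blast
      have sum: "x + y = (u + u') + (v + v') * d" by (simp add: x y algebra_simps)
      show "x + y \<in> ?E" unfolding sum by (intro E F.add uv)
      have prod: "x * y = (u * u' + v * v' * (d * d)) + (u * v' + v * u') * d"
        by (simp add: x y algebra_simps)
      show "x * y \<in> ?E" unfolding prod by (intro E F.add F.mult uv assms(2))
    next
      fix x assume "x \<in> ?E"
      then obtain u v where x: "x = u + v * d" and uv: "u \<in> F" "v \<in> F" by blast
      have neg: "- x = (- u) + (- v) * d" by (simp add: x)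
      show "- x \<in> ?E" unfolding neg by (intro E F.uminus uv)
    next
      fix x assume xE: "x \<in> ?E"
      then obtain u v where x: "x = u + v * d" and uv: "u \<in> F" "v \<in> F" by blast
      show "inverse x \<in> ?E"
      proof (cases "x = 0")
        case True
        then show ?thesis using xE by simp
      next
        case x0: False
        define N where "N = u * u - v * v * (d * d)"
        have NF: "N \<in> F" using uv assms(2) by (auto simp: N_def intro!: F.closed)
        have "u - v * d \<noteq> 0"
        proof
          assume "u - v * d = 0"
          then have "u = v * d" by simp
          moreover have "v \<noteq> 0" using x0 x calculation by auto
          ultimately have "d = u / v" by simp
          then show False using False F.divide[OF uv] by simp
        qed
        moreover have N: "N = x * (u - v * d)" by (simp add: N_def x algebra_simps)
        ultimately have inv: "inverse x = u / N + (- v / N) * d"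
          using x0 by (simp add: divide_simps)
        show ?thesis unfolding inv by (intro E F.divide F.uminus uv NF)
      qed
    qed
  qed
qed

section \<open>Irreducible rational cubics\<close>

locale irreducible_cubic =
  fixes a b c :: rat and l1 l2 l3 :: complex
  assumes irred: "Factorial_Ring.irreducible [:- c, - b, - a, 1:]"
    and factorization:
      "map_poly of_rat [:- c, - b, - a, 1:] = [:- l1, 1:] * [:- l2, 1:] * [:- l3, 1:]"
begin

abbreviation "p \<equiv> [:- c, - b, - a, 1:]"

text \<open>The square root of the discriminant: the 3-cycle of the roots fixes it and
  transpositions change its sign.\<close>

definition "\<delta> = (l1 - l2) * (l2 - l3) * (l3 - l1)"

text \<open>Reinterpreting the locale along this rotation transfers facts about \<open>l1\<close> to
  the other two roots.\<close>

lemma rotate: "irreducible_cubic a b c l2 l3 l1"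
  by unfold_locales (simp_all only: irred factorization mult_ac)

lemma delta_rotate: "irreducible_cubic.\<delta> l2 l3 l1 = \<delta>"
  unfolding \<delta>_def irreducible_cubic.\<delta>_def[OF rotate] by (simp add: mult_ac)

lemma rat_eval_p: "rat_eval p z = (z - l1) * (z - l2) * (z - l3)"
  unfolding rat_eval_def factorization by (simp only: poly_mult) simp

lemma root_iff: "rat_eval p z = 0 \<longleftrightarrow> z = l1 \<or> z = l2 \<or> z = l3"
  unfolding rat_eval_p by auto

lemma roots_distinct: "l1 \<noteq> l2" "l2 \<noteq> l3" "l3 \<noteq> l1"
proof -
  have "{z. rat_eval p z = 0} = {l1, l2, l3}" unfolding root_iff by auto
  then have "card {l1, l2, l3} = 3" using irreducible_card_roots[OF irred] by simp
  then show "l1 \<noteq> l2" "l2 \<noteq> l3" "l3 \<noteq> l1" by (auto simp: card_insert_if split: if_splits)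
qed

lemma vieta:
  shows "of_rat a = l1 + l2 + l3" "of_rat b = - (l1 * l2 + l1 * l3 + l2 * l3)"
    "of_rat c = l1 * l2 * l3"
proof -
  have "map_poly of_rat p = [:- of_rat c, - of_rat b, - of_rat a, 1 :: complex:]"
    by (simp add: map_poly_pCons of_rat_minus)
  with factorization
  have "[:- of_rat c, - of_rat b, - of_rat a, 1:] = [:- l1, 1:] * [:- l2, 1:] * [:- l3, 1:]"
    by simp
  then show "of_rat a = l1 + l2 + l3" "of_rat b = - (l1 * l2 + l1 * l3 + l2 * l3)"
    "of_rat c = l1 * l2 * l3"
    by (simp_all add: algebra_simps) (Groebner_Basis.algebra)+
qed

lemma root_irrational:
  assumes "rat_eval p z = 0"
  shows "z \<notin> \<rat>"
proof
  assume "z \<in> \<rat>"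
  then obtain r where "z = of_rat r" by (auto elim: Rats_cases)
  then have "rat_eval [:- r, 1:] z = 0" by (simp add: of_rat_minus)
  then have "p dvd [:- r, 1:]" using irreducible_dvd_iff[OF irred assms] by blast
  then show False using dvd_imp_degree_le[of p "[:- r, 1:]"] by simp
qed

lemma delta_square_rational: "\<delta> * \<delta> \<in> \<rat>"
proof -
  \<comment> \<open>The right-hand side is the discriminant of the cubic in terms of its
    coefficients.\<close>
  have "\<delta> * \<delta> = of_rat (a\<^sup>2 * b\<^sup>2 + 4 * b ^ 3 - 4 * a ^ 3 * c - 18 * a * b * c - 27 * c\<^sup>2)"
    unfolding of_rat_diff of_rat_add of_rat_mult of_rat_power vieta of_rat_numeral_eq \<delta>_def
    by Groebner_Basis.algebra
  then show ?thesis by simp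
qed

lemma pderiv_inverse:
  obtains s where "\<And>z. rat_eval p z = 0 \<Longrightarrow> rat_eval s z * rat_eval (pderiv p) z = 1"
proof -
  have "\<not> p dvd pderiv p"
    by (auto simp: pderiv_pCons dest!: dvd_imp_degree_le)
  then show ?thesis using irreducible_bezout[OF irred] that by metis
qed

lemma rat_eval_pderiv: "rat_eval (pderiv p) l1 = (l1 - l2) * (l1 - l3)"
proof -
  have "rat_eval (pderiv p) l1 = 3 * l1 ^ 2 - 2 * of_rat a * l1 - of_rat b"
    by (simp add: pderiv_pCons of_rat_minus of_rat_mult of_rat_add algebra_simps power2_eq_square)
  then show ?thesis unfolding vieta by (simp add: algebra_simps power2_eq_square)
qed

text \<open>Writing \<open>\<delta>\<close> as \<open>- (l2 - l3) p'(l1)\<close> gives \<open>l2 - l3\<close>, while \<open>l2 + l3 = a - l1\<close>.\<close>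

lemma next_root:
  obtains s where "l2 = (of_rat a - l1 - \<delta> * rat_eval s l1) / 2"
    "l3 = (of_rat a - l2 - \<delta> * rat_eval s l2) / 2" "l1 = (of_rat a - l3 - \<delta> * rat_eval s l3) / 2"
proof -
  obtain s where s: "\<And>z. rat_eval p z = 0 \<Longrightarrow> rat_eval s z * rat_eval (pderiv p) z = 1"
    using pderiv_inverse by blast
  \<comment> \<open>Stated for any ordering of the roots with the same \<delta>, so that its
    instances along the 3-cycle share one polynomial \<open>s\<close>.\<close>
  have *: "y = (of_rat a - x - \<delta> * rat_eval s x) / 2"
    if "irreducible_cubic a b c x y z" "irreducible_cubic.\<delta> x y z = \<delta>" "rat_eval p x = 0" for x y z
  proof -
    interpret r: irreducible_cubic a b c x y z by fact
    have "\<delta> * rat_eval s x = - (y - z) * (rat_eval s x * rat_eval (pderiv p) x)"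
      unfolding that(2)[symmetric] r.\<delta>_def r.rat_eval_pderiv by Groebner_Basis.algebra
    then show ?thesis using s[OF that(3)] by (simp add: r.vieta)
  qed
  interpret r: irreducible_cubic a b c l2 l3 l1 by (rule rotate)
  have "rat_eval p l1 = 0" "rat_eval p l2 = 0" "rat_eval p l3 = 0"
    unfolding root_iff by simp_all
  moreover have "irreducible_cubic.\<delta> l1 l2 l3 = \<delta>" "irreducible_cubic.\<delta> l2 l3 l1 = \<delta>"
    "irreducible_cubic.\<delta> l3 l1 l2 = \<delta>"
    by (simp_all only: delta_rotate r.delta_rotate)
  ultimately show ?thesis
    using that[of s] *[OF irreducible_cubic_axioms] *[OF rotate] *[OF r.rotate] by metis
qed

section \<open>Rational \<delta> and the Galois property\<close>

lemma next_root_rational: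
  assumes "\<delta> \<in> \<rat>"
  obtains g where "rat_eval g l1 = l2" "rat_eval g l2 = l3" "rat_eval g l3 = l1"
proof -
  obtain d where d: "\<delta> = of_rat d" using assms by (auto elim: Rats_cases)
  obtain s where s: "l2 = (of_rat a - l1 - \<delta> * rat_eval s l1) / 2"
    "l3 = (of_rat a - l2 - \<delta> * rat_eval s l2) / 2" "l1 = (of_rat a - l3 - \<delta> * rat_eval s l3) / 2"
    using next_root by blast
  \<comment> \<open>With \<delta> replaced by the rational \<open>d\<close>, the formula for the
    next root becomes a single polynomial over \<rat>.\<close>
  define g where "g = Polynomial.smult (1/2) ([:a, - 1:] - Polynomial.smult d s)"
  have g: "rat_eval g z = (of_rat a - z - \<delta> * rat_eval s z) / 2" for z
    by (simp add: g_def d of_rat_divide of_rat_minus)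
  show ?thesis
    by (rule that[of g]; subst g; rule s[symmetric])
qed

text \<open>All roots are polynomials in \<open>l1\<close>, so sending \<open>l1\<close> to
  \<open>l2\<close> defines an automorphism of \<rat>(l1) that rotates the roots. An element fixed
  by it takes the same value at all three roots and is therefore rational.\<close>

lemma delta_rational_imp_galois:
  assumes "\<delta> \<in> \<rat>"
  shows "galois_extension complex_field \<rat> (rat_adjoin {l1})"
proof -
  interpret C: field complex_field by (rule field_from_type_algebra)
  interpret Q: complex_subfield "rat_adjoin {l1}" by (rule complex_subfield_rat_adjoin)
  obtain g where g: "rat_eval g l1 = l2" "rat_eval g l2 = l3" "rat_eval g l3 = l1"
    using next_root_rational[OF assms] by blast
  have p: "rat_eval p l1 = 0" "rat_eval p l2 = 0" "rat_eval p l3 = 0"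
    unfolding root_iff by simp_all
  have K: "rat_adjoin {l1} = range (\<lambda>h. rat_eval h l1)"
    by (rule rat_adjoin_algebraic[OF irred p(1)])
  have fixed: "y \<in> \<rat>" if "rat_eval h l1 = y" "rat_eval h l2 = y" "rat_eval h l3 = y" for h y
    by (rule conjugation_invariant_rational[OF irred, of h]) (use that root_iff in auto)

  \<comment> \<open>Any representing polynomial may be chosen; \<open>conjugate_eq\<close> shows
    that the value at \<open>l2\<close> does not depend on the choice.\<close>
  define \<sigma> where "\<sigma> y = rat_eval (SOME h. rat_eval h l1 = y) l2" for y
  have \<sigma>: "\<sigma> (rat_eval h l1) = rat_eval h l2" for h
  proof -
    have "rat_eval (SOME h'. rat_eval h' l1 = rat_eval h l1) l1 = rat_eval h l1"
      by (rule someI[of _ h]) simp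
    then show ?thesis unfolding \<sigma>_def by (rule conjugate_eq[OF irred p(1,2)])
  qed
  have \<sigma>_closed: "\<sigma> y \<in> rat_adjoin {l1}" if "y \<in> rat_adjoin {l1}" for y
  proof -
    from that obtain h where "y = rat_eval h l1" using K by auto
    then have "\<sigma> y = rat_eval (pcompose h g) l1" by (simp add: \<sigma> g)
    then show ?thesis unfolding K by (rule range_eqI)
  qed
  have bij: "bij_betw \<sigma> (rat_adjoin {l1}) (rat_adjoin {l1})"
  proof (rule bij_betwI')
    fix x y assume "x \<in> rat_adjoin {l1}" "y \<in> rat_adjoin {l1}"
    then obtain h k where "x = rat_eval h l1" "y = rat_eval k l1" using K by auto
    then show "\<sigma> x = \<sigma> y \<longleftrightarrow> x = y"
      using conjugate_eq[OF irred p(1,2), of h k] conjugate_eq[OF irred p(2,1), of h k]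
      by (auto simp: \<sigma>)
  next
    fix y assume "y \<in> rat_adjoin {l1}"
    then obtain h where "y = rat_eval h l1" using K by auto
    \<comment> \<open>Three applications of \<open>g\<close> return to the same root, so
      substituting \<open>g\<close> twice inverts the automorphism.\<close>
    then have "y = \<sigma> (rat_eval (pcompose (pcompose h g) g) l1)"
      unfolding \<sigma> by (simp add: g)
    then show "\<exists>x\<in>rat_adjoin {l1}. y = \<sigma> x" using K by blast
  qed (rule \<sigma>_closed)
  have hom: "\<sigma> (x + y) = \<sigma> x + \<sigma> y" "\<sigma> (x * y) = \<sigma> x * \<sigma> y"
    if xy: "x \<in> rat_adjoin {l1}" "y \<in> rat_adjoin {l1}" for x y
  proof -
    from xy obtain h k where hk: "x = rat_eval h l1" "y = rat_eval k l1" using K by auto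
    show "\<sigma> (x + y) = \<sigma> x + \<sigma> y" using \<sigma>[of "h + k"] by (simp add: hk \<sigma>)
    show "\<sigma> (x * y) = \<sigma> x * \<sigma> y" using \<sigma>[of "h * k"] by (simp add: hk \<sigma>)
  qed
  have \<sigma>_Rats: "\<sigma> x = x" if "x \<in> \<rat>" for x
  proof -
    from that obtain r where "x = of_rat r" by (auto elim: Rats_cases)
    then show ?thesis using \<sigma>[of "[:r:]"] by simp
  qed
  have "\<sigma> \<in> ring_iso (complex_field\<lparr>carrier := rat_adjoin {l1}\<rparr>) (complex_field\<lparr>carrier := rat_adjoin {l1}\<rparr>)"
    by (rule ring_iso_memI)
      (use \<sigma>_closed hom bij \<sigma>_Rats[OF Rats_1] in \<open>auto simp: ring_of_type_algebra_def\<close>)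
  then have \<sigma>_aut: "\<sigma> \<in> field_auts complex_field \<rat> (rat_adjoin {l1})"
    by (simp add: field_auts_def \<sigma>_Rats)

  have algebraic: "\<not> C.transcendental \<rat> x" if "x \<in> rat_adjoin {l1}" for x
  proof -
    from that obtain h where h: "x = rat_eval h l1" using K by auto
    define y where "y = rat_eval h l2"
    define z where "z = rat_eval h l3"
    \<comment> \<open>At the three roots, \<open>h'\<close> and \<open>h''\<close> take the values
      of \<open>h\<close> rotated by one and two places. Symmetric expressions in \<open>h\<close>,
      \<open>h'\<close>, \<open>h''\<close> are thus constant on the roots, which makes the
      coefficients of the cubic (X - x)(X - y)(X - z) rational.\<close>
    define h' where "h' = pcompose h g"
    define h'' where "h'' = pcompose h' g"
    define e1 where "e1 = x + y + z"
    define e2 where "e2 = x * y + y * z + z * x"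
    define e3 where "e3 = x * y * z"
    have "e1 \<in> \<rat>"
      by (rule fixed[of "h + h' + h''"]) (simp_all add: e1_def h y_def z_def h'_def h''_def g)
    moreover have "e2 \<in> \<rat>"
      by (rule fixed[of "h * h' + h' * h'' + h'' * h"])
        (simp_all add: e2_def h y_def z_def h'_def h''_def g)
    moreover have "e3 \<in> \<rat>"
      by (rule fixed[of "h * h' * h''"]) (simp_all add: e3_def h y_def z_def h'_def h''_def g)
    ultimately have "[1, - e1, e2, - e3] \<in> carrier (\<rat> [X]\<^bsub>complex_field\<^esub>)"
      unfolding univ_poly_carrier[symmetric] polynomial_def
      by (simp add: ring_of_type_algebra_def)
    moreover have "C.eval [1, - e1, e2, - e3] x = ring.zero complex_field"
      unfolding C.eval.simps list.sel
      by (simp add: ring_of_type_algebra_def nat_pow_def e1_def e2_def e3_def algebra_simps)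
    ultimately show ?thesis
      using C.algebraicI[of _ \<rat> x] unfolding over_def by blast
  qed
  have fixed_field: "{x \<in> rat_adjoin {l1}. \<forall>\<tau>\<in>field_auts complex_field \<rat> (rat_adjoin {l1}). \<tau> x = x} = \<rat>"
  proof safe
    fix x assume x: "x \<in> rat_adjoin {l1}"
      and inv: "\<forall>\<tau>\<in>field_auts complex_field \<rat> (rat_adjoin {l1}). \<tau> x = x"
    from x obtain h where h: "x = rat_eval h l1" using K by auto
    have x2: "rat_eval h l2 = x" using inv \<sigma>_aut h \<sigma> by auto
    \<comment> \<open>Invariance under the automorphism says that \<open>h\<close> and its
      substitution by \<open>g\<close> agree at \<open>l1\<close>; conjugating this equality to
      \<open>l2\<close> reaches \<open>l3\<close>.\<close>
    have "rat_eval h l2 = rat_eval (pcompose h g) l2"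
      by (rule conjugate_eq[OF irred p(1,2)]) (simp add: g h[symmetric] x2)
    then have "rat_eval h l3 = x" by (simp add: g x2)
    then show "x \<in> \<rat>" using fixed h x2 by metis
  next
    fix x :: complex assume "x \<in> \<rat>"
    then show "x \<in> rat_adjoin {l1}" by (rule Q.Rats)
  next
    fix \<tau> and x :: complex
    assume "x \<in> \<rat>" "\<tau> \<in> field_auts complex_field \<rat> (rat_adjoin {l1})"
    then show "\<tau> x = x" by (simp add: field_auts_def)
  qed
  show ?thesis
    unfolding galois_extension_def
    by (intro conjI subfield_Rats subfield_rat_adjoin ballI subsetI fixed_field;
        erule Q.Rats algebraic)
qed

section \<open>Roots of the cubic versus cyclotomic fields and their quadratic extensions\<close>

text \<open>The conjugations \<open>\<zeta> \<mapsto> \<zeta> ^ k\<close> commute and permute the three roots transitively, hence act as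
  a cyclic group: one that fixes a root fixes all of them. So \<open>\<delta>\<close> would be fixed by all of them.\<close>

lemma root_not_cyclotomic:
  assumes m: "Factorial_Ring.irreducible m" "rat_eval m \<zeta> = 0"
    and powers: "\<And>z. rat_eval m z = 0 \<Longrightarrow> \<exists>k. z = \<zeta> ^ k"
    and irrational: "\<delta> \<notin> \<rat>"
  shows "l1 \<notin> range (\<lambda>h. rat_eval h \<zeta>)"
proof
  assume "l1 \<in> range (\<lambda>h. rat_eval h \<zeta>)"
  then obtain h where h: "rat_eval h \<zeta> = l1" by auto
  define H where "H k = pcompose h ([:0, 1:] ^ k)" for k
  have H: "rat_eval (H k) z = rat_eval h (z ^ k)" for k z
    by (simp add: H_def)
  have root: "rat_eval h z = l1 \<or> rat_eval h z = l2 \<or> rat_eval h z = l3" if "rat_eval m z = 0" for z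
  proof -
    have "rat_eval (pcompose p h) \<zeta> = 0"
      unfolding rat_eval_pcompose h root_iff by simp
    then have "rat_eval (pcompose p h) z = 0" by (rule conjugate_vanishing[OF m that])
    then show ?thesis unfolding rat_eval_pcompose root_iff .
  qed
  have pow_root: "rat_eval m (z ^ k) = 0" if "rat_eval m (\<zeta> ^ k) = 0" "rat_eval m z = 0" for z k
    using conjugate_vanishing[OF m that(2), of "pcompose m ([:0, 1:] ^ k)"] that(1) by simp

  \<comment> \<open>If only \<open>l1\<close> and \<open>y\<close> occurred as conjugates of
    \<open>l1\<close>, a conjugation taking \<open>l1\<close> to \<open>y\<close> would exchange
    them at every z, so their sum would be rational. By the rationality of \<open>a\<close> the
    remaining root would then be rational too. Hence all three roots occur.\<close>
  have two: "l1 \<in> \<rat> \<or> l1 + y \<in> \<rat>"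
    if y: "y \<noteq> l1" "\<And>w. rat_eval m w = 0 \<Longrightarrow> rat_eval h w = l1 \<or> rat_eval h w = y" for y
  proof (cases "\<exists>w. rat_eval m w = 0 \<and> rat_eval h w = y")
    case True
    then obtain k where k: "rat_eval m (\<zeta> ^ k) = 0" "rat_eval h (\<zeta> ^ k) = y"
      using powers by blast
    have "rat_eval (h + H k) z = l1 + y" if z: "rat_eval m z = 0" for z
    proof -
      have "rat_eval h z \<noteq> rat_eval (H k) z"
        using conjugate_eq[OF m(1) z m(2), of h "H k"] k(2) h y(1) by (auto simp: H)
      then show ?thesis using y(2)[OF z] y(2)[OF pow_root[OF k(1) z]] by (auto simp: H)
    qed
    then have "l1 + y \<in> \<rat>" by (rule conjugation_invariant_rational[OF m(1)])
    then show ?thesis ..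
  next
    case False
    then have "rat_eval h w = l1" if "rat_eval m w = 0" for w
      using y(2) that by blast
    then have "l1 \<in> \<rat>" by (rule conjugation_invariant_rational[OF m(1)])
    then show ?thesis ..
  qed
  have irr: "l1 \<notin> \<rat>" "l2 \<notin> \<rat>" "l3 \<notin> \<rat>"
    using root_irrational root_iff by auto
  have "\<exists>w. rat_eval m w = 0 \<and> rat_eval h w = l2"
  proof (rule ccontr)
    assume "\<not> ?thesis"
    then have "l1 + l3 \<in> \<rat>" using two[of l3] root roots_distinct irr by blast
    then have "of_rat a - (l1 + l3) \<in> \<rat>" by simp
    then show False using irr by (simp add: vieta)
  qed
  then obtain k2 where k2: "rat_eval m (\<zeta> ^ k2) = 0" "rat_eval h (\<zeta> ^ k2) = l2"
    using powers by blast
  have "\<exists>w. rat_eval m w = 0 \<and> rat_eval h w = l3"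
  proof (rule ccontr)
    assume "\<not> ?thesis"
    then have "l1 + l2 \<in> \<rat>" using two[of l2] root roots_distinct irr by metis
    then have "of_rat a - (l1 + l2) \<in> \<rat>" by simp
    then show False using irr by (simp add: vieta)
  qed
  then obtain k3 where k3: "rat_eval m (\<zeta> ^ k3) = 0" "rat_eval h (\<zeta> ^ k3) = l3"
    using powers by blast

  have "rat_eval ((h - H k2) * (H k2 - H k3) * (H k3 - h)) z = \<delta>" if z: "rat_eval m z = 0" for z
  proof -
    define x1 where "x1 = rat_eval h z"
    define x2 where "x2 = rat_eval h (z ^ k2)"
    define x3 where "x3 = rat_eval h (z ^ k3)"
    have "x1 \<in> {l1, l2, l3}" "x2 \<in> {l1, l2, l3}" "x3 \<in> {l1, l2, l3}"
      unfolding x1_def x2_def x3_def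
      using root[OF z] root[OF pow_root[OF k2(1) z]] root[OF pow_root[OF k3(1) z]] by auto
    moreover have "x1 \<noteq> x2"
      using conjugate_eq[OF m(1) z m(2), of h "H k2"] k2(2) h roots_distinct
      by (auto simp: H x1_def x2_def)
    moreover have "x2 \<noteq> x3"
      using conjugate_eq[OF m(1) z m(2), of "H k2" "H k3"] k2(2) k3(2) roots_distinct
      by (auto simp: H x3_def x2_def)
    moreover have "x3 \<noteq> x1"
      using conjugate_eq[OF m(1) z m(2), of "H k3" h] h k3(2) roots_distinct
      by (auto simp: H x3_def x1_def)
    \<comment> \<open>Since z is a power of \<zeta>, the conjugation to z commutes with those taking
      \<open>l1\<close> to \<open>l2\<close> and to \<open>l3\<close>. It therefore fixes all roots
      or none, so it is the identity or a 3-cycle, and both preserve \<delta>.\<close>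
    moreover have "x1 = l1 \<longleftrightarrow> x2 = l2" "x1 = l1 \<longleftrightarrow> x3 = l3"
    proof -
      obtain l where l: "z = \<zeta> ^ l" using powers[OF z] by blast
      have swap: "z ^ k = (\<zeta> ^ k) ^ l" for k
        unfolding l by (metis mult.commute power_mult)
      have "x1 = l1 \<longleftrightarrow> rat_eval h (z ^ k) = rat_eval h (\<zeta> ^ k)" if "rat_eval m (\<zeta> ^ k) = 0" for k
      proof -
        have "x1 = l1 \<longleftrightarrow> rat_eval (H l) \<zeta> = rat_eval h \<zeta>" by (simp add: x1_def H l h)
        also have "\<dots> \<longleftrightarrow> rat_eval (H l) (\<zeta> ^ k) = rat_eval h (\<zeta> ^ k)"
          using conjugate_eq[OF m that] conjugate_eq[OF m(1) that m(2)] by blast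
        finally show ?thesis by (simp add: H swap)
      qed
      from this[OF k2(1)] this[OF k3(1)] show "x1 = l1 \<longleftrightarrow> x2 = l2" "x1 = l1 \<longleftrightarrow> x3 = l3"
        by (simp_all add: k2 k3 x2_def x3_def)
    qed
    ultimately have "(x1 - x2) * (x2 - x3) * (x3 - x1) = \<delta>"
      unfolding \<delta>_def using roots_distinct by (auto simp: mult_ac)
    then show ?thesis by (simp add: H x1_def x2_def x3_def)
  qed
  then have "\<delta> \<in> \<rat>" by (rule conjugation_invariant_rational[OF m(1)])
  with irrational show False ..
qed

text \<open>Otherwise \<open>u - v * d\<close> would be a second root, and the third root,
  \<open>a\<close> minus the trace \<open>2 * u\<close>, would lie in \<open>F\<close>.\<close>

lemma root_not_in_quadratic_extension:
  assumes "complex_subfield F" "d * d \<in> F"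
    and no_root: "l1 \<notin> F" "l2 \<notin> F" "l3 \<notin> F" and "u \<in> F" "v \<in> F"
  shows "rat_eval p (u + v * d) \<noteq> 0"
proof
  interpret F: complex_subfield F by fact
  have not_root: "rat_eval p x \<noteq> 0" if "x \<in> F" for x
    unfolding root_iff using that no_root by auto
  assume r: "rat_eval p (u + v * d) = 0"
  have "u + v * d \<notin> F" using r not_root by blast
  then have dF: "d \<notin> F" and v0: "v \<noteq> 0" using assms F.add F.mult by auto
  define D where "D = d * d"
  \<comment> \<open>The values of the cubic at \<open>u + v * d\<close> and \<open>u - v * d\<close>
    are \<open>A + B * d\<close> and \<open>A - B * d\<close>. As \<open>d\<close> is not in
    \<open>F\<close>, a zero of the first forces \<open>A = B = 0\<close>.\<close>
  define A where "A = u * u * u + 3 * u * v * v * D - of_rat a * (u * u + v * v * D) - of_rat b * u - of_rat c"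
  define B where "B = 3 * u * u * v + v * v * v * D - 2 * of_rat a * u * v - of_rat b * v"
  have num: "3 \<in> F" "2 \<in> F" using F.of_nat[of 3] F.of_nat[of 2] by simp_all
  have "A \<in> F"
    unfolding A_def D_def by (intro F.diff F.add F.mult F.of_rat assms num)
  have "B \<in> F"
    unfolding B_def D_def by (intro F.diff F.add F.mult F.of_rat assms num)
  have eq: "rat_eval p (u + v * d) = A + B * d" "rat_eval p (u - v * d) = A - B * d"
    by (simp_all add: A_def B_def D_def of_rat_minus algebra_simps)
  have "B = 0"
  proof (rule ccontr)
    assume B: "B \<noteq> 0"
    have "B * d = - A" using r unfolding eq by (simp add: add_eq_0_iff)
    then have "d = - A / B" using B by (simp add: field_simps)
    then show False using dF \<open>A \<in> F\<close> \<open>B \<in> F\<close> F.divide F.uminus by blast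
  qed
  moreover have "A = 0" using r calculation unfolding eq by simp
  ultimately have r': "rat_eval p (u - v * d) = 0" unfolding eq by simp
  have "d \<noteq> 0" using dF F.zero by auto
  with v0 have "u + v * d \<noteq> u - v * d" by (simp add: eq_neg_iff_add_eq_0)
  with r r' have "of_rat a - ((u + v * d) + (u - v * d)) \<in> {l1, l2, l3}"
    unfolding root_iff vieta by auto
  moreover have "of_rat a - ((u + v * d) + (u - v * d)) \<in> F"
    using F.diff[OF F.of_rat F.add[OF \<open>u \<in> F\<close> \<open>u \<in> F\<close>]] by simp
  ultimately show False using no_root by auto
qed

section \<open>The 3-cycle acting over an extension field\<close>

text \<open>The triples \<open>(h(l1), h(l2), h(l3))\<close> with \<open>h\<close> a polynomial over \<open>E\<close>;
  reducing modulo the cubic, degree at most 2 suffices.\<close>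

definition value_triples :: "complex set \<Rightarrow> (complex \<times> complex \<times> complex) set" where
  "value_triples E = {(u + v * l1 + w * l1\<^sup>2, u + v * l2 + w * l2\<^sup>2, u + v * l3 + w * l3\<^sup>2) |u v w.
     u \<in> E \<and> v \<in> E \<and> w \<in> E}"

lemma root_cube:
  assumes "rat_eval p z = 0"
  shows "z * z\<^sup>2 = of_rat a * z\<^sup>2 + of_rat b * z + of_rat c"
  using assms by (simp add: of_rat_minus algebra_simps power2_eq_square)

context
  fixes E
  assumes E: "complex_subfield E"
begin

interpretation E: complex_subfield E by (rule E)

lemma value_triplesI:
  assumes "u \<in> E" "v \<in> E" "w \<in> E"
    and "x = u + v * l1 + w * l1\<^sup>2" "y = u + v * l2 + w * l2\<^sup>2" "z = u + v * l3 + w * l3\<^sup>2"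
  shows "(x, y, z) \<in> value_triples E"
  using assms unfolding value_triples_def by blast

lemma value_triplesE:
  assumes "(x, y, z) \<in> value_triples E"
  obtains u v w where "u \<in> E" "v \<in> E" "w \<in> E"
    "x = u + v * l1 + w * l1\<^sup>2" "y = u + v * l2 + w * l2\<^sup>2" "z = u + v * l3 + w * l3\<^sup>2"
  using assms unfolding value_triples_def by blast

lemma value_triples_const: "u \<in> E \<Longrightarrow> (u, u, u) \<in> value_triples E"
  by (rule value_triplesI[of u 0 0]) (simp_all add: E.zero)

lemma value_triples_roots: "(l1, l2, l3) \<in> value_triples E"
  by (rule value_triplesI[of 0 1 0]) (simp_all add: E.zero E.one)

lemma value_triples_add:
  assumes "(x, y, z) \<in> value_triples E" "(x', y', z') \<in> value_triples E"
  shows "(x + x', y + y', z + z') \<in> value_triples E"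
proof -
  from assms(1) obtain u v w where 1: "u \<in> E" "v \<in> E" "w \<in> E"
    "x = u + v * l1 + w * l1\<^sup>2" "y = u + v * l2 + w * l2\<^sup>2" "z = u + v * l3 + w * l3\<^sup>2"
    by (rule value_triplesE)
  from assms(2) obtain u' v' w' where 2: "u' \<in> E" "v' \<in> E" "w' \<in> E"
    "x' = u' + v' * l1 + w' * l1\<^sup>2" "y' = u' + v' * l2 + w' * l2\<^sup>2" "z' = u' + v' * l3 + w' * l3\<^sup>2"
    by (rule value_triplesE)
  show ?thesis
    by (rule value_triplesI[of "u + u'" "v + v'" "w + w'"])
      (simp_all add: 1 2 E.add algebra_simps)
qed

lemma value_triples_scale:
  assumes "(x, y, z) \<in> value_triples E" "r \<in> E"
  shows "(r * x, r * y, r * z) \<in> value_triples E"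
proof -
  from assms(1) obtain u v w where 1: "u \<in> E" "v \<in> E" "w \<in> E"
    "x = u + v * l1 + w * l1\<^sup>2" "y = u + v * l2 + w * l2\<^sup>2" "z = u + v * l3 + w * l3\<^sup>2"
    by (rule value_triplesE)
  show ?thesis
    by (rule value_triplesI[of "r * u" "r * v" "r * w"])
      (simp_all add: 1 E.mult assms(2) algebra_simps)
qed

lemma value_triples_times_root:
  assumes "(x, y, z) \<in> value_triples E"
  shows "(l1 * x, l2 * y, l3 * z) \<in> value_triples E"
proof -
  from assms obtain u v w where 1: "u \<in> E" "v \<in> E" "w \<in> E"
    "x = u + v * l1 + w * l1\<^sup>2" "y = u + v * l2 + w * l2\<^sup>2" "z = u + v * l3 + w * l3\<^sup>2"
    by (rule value_triplesE)
  have *: "t * (u + v * t + w * t\<^sup>2)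
      = w * of_rat c + (u + w * of_rat b) * t + (v + w * of_rat a) * t\<^sup>2"
    if "rat_eval p t = 0" for t
  proof -
    have "t * (u + v * t + w * t\<^sup>2) = u * t + v * t\<^sup>2 + w * (t * t\<^sup>2)"
      by (simp add: algebra_simps power2_eq_square)
    then show ?thesis unfolding root_cube[OF that] by (simp add: algebra_simps)
  qed
  show ?thesis
    by (rule value_triplesI[of "w * of_rat c" "u + w * of_rat b" "v + w * of_rat a"];
        (intro E.add E.mult E.of_rat 1)?)
      (simp_all only: 1 * root_iff simp_thms)
qed

lemma value_triples_mult:
  assumes "(x, y, z) \<in> value_triples E" "(x', y', z') \<in> value_triples E"
  shows "(x * x', y * y', z * z') \<in> value_triples E"
proof -
  from assms(1) obtain u v w where 1: "u \<in> E" "v \<in> E" "w \<in> E"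
    "x = u + v * l1 + w * l1\<^sup>2" "y = u + v * l2 + w * l2\<^sup>2" "z = u + v * l3 + w * l3\<^sup>2"
    by (rule value_triplesE)
  note t = value_triples_times_root[OF assms(2)]
  show ?thesis
    using value_triples_add[OF value_triples_add[OF value_triples_scale[OF assms(2) 1(1)]
          value_triples_scale[OF t 1(2)]] value_triples_scale[OF value_triples_times_root[OF t] 1(3)]]
    by (simp add: 1 algebra_simps power2_eq_square)
qed

lemma value_triples_rat_eval:
  assumes "(x, y, z) \<in> value_triples E"
  shows "(rat_eval h x, rat_eval h y, rat_eval h z) \<in> value_triples E"
proof (induction h)
  case 0
  show ?case using value_triples_const[OF E.zero] by simp
next
  case (pCons r h)
  show ?case
    using value_triples_add[OF value_triples_const[OF E.of_rat] value_triples_mult[OF assms pCons.IH]]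
    by simp
qed

lemma value_triples_next_root:
  assumes "\<delta> \<in> E"
  shows "(l2, l3, l1) \<in> value_triples E"
proof -
  obtain s where s: "l2 = (of_rat a - l1 - \<delta> * rat_eval s l1) / 2"
    "l3 = (of_rat a - l2 - \<delta> * rat_eval s l2) / 2" "l1 = (of_rat a - l3 - \<delta> * rat_eval s l3) / 2"
    using next_root by blast
  have "- 1 / 2 \<in> E" using E.of_rat[of "- 1 / 2"] by (simp add: of_rat_divide of_rat_minus)
  from value_triples_scale[OF value_triples_add[OF value_triples_const[OF E.of_rat[of "- a"]]
        value_triples_add[OF value_triples_roots
         value_triples_scale[OF value_triples_rat_eval[OF value_triples_roots] assms]]] this]
  have "(- 1 / 2 * (of_rat (- a) + (l1 + \<delta> * rat_eval s l1)),
     - 1 / 2 * (of_rat (- a) + (l2 + \<delta> * rat_eval s l2)),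
     - 1 / 2 * (of_rat (- a) + (l3 + \<delta> * rat_eval s l3))) \<in> value_triples E" .
  moreover have "- 1 / 2 * (of_rat (- a) + (z + \<delta> * rat_eval s z))
      = (of_rat a - z - \<delta> * rat_eval s z) / 2" for z
    by (simp add: of_rat_minus field_simps)
  ultimately show ?thesis by (simp only: s[symmetric])
qed

text \<open>A cubic without roots in \<open>E\<close> is irreducible over \<open>E\<close>, so a
  polynomial over \<open>E\<close> of degree at most 2 that vanishes at \<open>l1\<close> is
  zero.\<close>

lemma value_triples_zero:
  assumes no_root: "l1 \<notin> E" "l2 \<notin> E" "l3 \<notin> E"
    and "(0, y, z) \<in> value_triples E"
  shows "y = 0" "z = 0"
proof -
  from assms(4) obtain u v w where 1: "u \<in> E" "v \<in> E" "w \<in> E"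
    "0 = u + v * l1 + w * l1\<^sup>2" "y = u + v * l2 + w * l2\<^sup>2" "z = u + v * l3 + w * l3\<^sup>2"
    by (rule value_triplesE)
  have lin: "s = 0 \<and> t = 0" if st: "s \<in> E" "t \<in> E" "s + t * l1 = 0" for s t
  proof -
    have "t = 0"
    proof (rule ccontr)
      assume "t \<noteq> 0"
      with st(3) have "l1 = - s / t" by (simp add: field_simps add_eq_0_iff)
      then show False using no_root st E.divide E.uminus by metis
    qed
    with st show ?thesis by simp
  qed
  have "w = 0"
  proof (rule ccontr)
    assume w: "w \<noteq> 0"
    define s where "s = u / w"
    define t where "t = v / w"
    have st: "s \<in> E" "t \<in> E" using 1 by (simp_all add: s_def t_def E.divide)
    have sq: "l1\<^sup>2 = - s - t * l1" using 1(4) w by (simp add: s_def t_def field_simps add_eq_0_iff)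
    have "rat_eval p l1 = 0" unfolding root_iff by simp
    \<comment> \<open>Up to sign this is the remainder of the cubic modulo X^2 + t X + s, evaluated
      at \<open>l1\<close>.\<close>
    then have "(- (t * s) - of_rat a * s + of_rat c) + (s - t * t - of_rat a * t + of_rat b) * l1 = 0"
      using root_cube[of l1] sq by (simp add: power2_eq_square) Groebner_Basis.algebra
    then have "- (t * s) - of_rat a * s + of_rat c = 0 \<and> s - t * t - of_rat a * t + of_rat b = 0"
      using st by (intro lin) (auto intro!: E.closed)
    \<comment> \<open>The quadratic X^2 + t X + s now divides the cubic and its roots add up to
      \<open>- t\<close>, which leaves \<open>a + t\<close> as the third root.\<close>
    then have "rat_eval p (of_rat a + t) = 0"
      by (simp add: of_rat_minus) Groebner_Basis.algebra
    moreover have "of_rat a + t \<in> E" using st E.add E.of_rat by blast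
    ultimately show False using no_root unfolding root_iff by metis
  qed
  moreover from this have "u = 0 \<and> v = 0" using lin[OF 1(1,2)] 1(4) by simp
  ultimately show "y = 0" "z = 0" using 1 by simp_all
qed

text \<open>No root lies in \<open>E\<close>, but \<open>l2\<close> is a polynomial in \<open>l1\<close> over \<open>E\<close>: the Galois group over
  \<open>E\<close> is generated by the 3-cycle, which may be applied to any relation over \<open>E\<close>.\<close>

lemma relation_rotate:
  assumes "\<delta> \<in> E" and no_root: "l1 \<notin> E" "l2 \<notin> E" "l3 \<notin> E" and z: "z1 \<in> E" "z2 \<in> E" "z3 \<in> E"
    and rel: "z1 * rat_eval f l1 + z2 * rat_eval f l2 + z3 * rat_eval f l3 = 0"
  shows "z1 * rat_eval f l2 + z2 * rat_eval f l3 + z3 * rat_eval f l1 = 0"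
    and "z1 * rat_eval f l3 + z2 * rat_eval f l1 + z3 * rat_eval f l2 = 0"
proof -
  note r1 = value_triples_roots and r2 = value_triples_next_root[OF assms(1)]
  have r3: "(l3, l1, l2) \<in> value_triples E"
    using value_triples_add[OF value_triples_const[OF E.of_rat[of a]]
        value_triples_scale[OF value_triples_add[OF r1 r2] E.uminus[OF E.one]]]
    by (simp add: vieta)
  \<comment> \<open>The relation and its two rotations are the values of one polynomial over
    \<open>E\<close> at the three roots; the first value is zero, hence so are the others.\<close>
  have "(z1 * rat_eval f l1 + z2 * rat_eval f l2 + z3 * rat_eval f l3,
      z1 * rat_eval f l2 + z2 * rat_eval f l3 + z3 * rat_eval f l1,
      z1 * rat_eval f l3 + z2 * rat_eval f l1 + z3 * rat_eval f l2) \<in> value_triples E"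
    by (intro value_triples_add value_triples_scale value_triples_rat_eval r1 r2 r3 z)
  then show "z1 * rat_eval f l2 + z2 * rat_eval f l3 + z3 * rat_eval f l1 = 0"
    "z1 * rat_eval f l3 + z2 * rat_eval f l1 + z3 * rat_eval f l2 = 0"
    unfolding rel by (intro value_triples_zero[OF no_root]; assumption)+
qed

end

end

section \<open>Twisted sums of conjugates\<close>

lemma primitive_cube_root:
  assumes "\<omega>\<^sup>2 + \<omega> + 1 = 0"
  shows "primitive_root_of_unity 3 \<omega>"
proof -
  have cube: "\<omega> ^ 3 = 1" using assms by Groebner_Basis.algebra
  have "\<omega> \<noteq> 1" using assms by auto
  moreover have "\<omega>\<^sup>2 \<noteq> 1"
  proof
    assume "\<omega>\<^sup>2 = 1"
    then have "\<omega> = 1" using cube by (simp add: power3_eq_cube power2_eq_square)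
    with calculation show False ..
  qed
  moreover have "k = 1 \<or> k = 2" if "0 < k \<and> k < 3" for k :: nat using that by auto
  ultimately have "\<omega> ^ k \<noteq> 1" if "0 < k \<and> k < 3" for k :: nat
    using that by (metis power_one_right)
  then show ?thesis unfolding primitive_root_of_unity_def using cube by simp
qed

text \<open>The discrete Fourier transform diagonalizes the circulant system. Nonzero eigenvalues
  force the three Fourier coefficients of \<open>(w1, w2, w3)\<close> to vanish, and these add up to
  \<open>3 * w1\<close>.\<close>

lemma circulant_kernel:
  fixes x y z :: complex
  assumes "w1 * x + w2 * y + w3 * z = 0" "w1 * y + w2 * z + w3 * x = 0" "w1 * z + w2 * x + w3 * y = 0"
    and \<omega>: "\<omega>\<^sup>2 + \<omega> + 1 = 0"
    and nonzero: "x + y + z \<noteq> 0" "x + \<omega> * y + \<omega>\<^sup>2 * z \<noteq> 0" "x + \<omega>\<^sup>2 * y + \<omega> * z \<noteq> 0"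
  shows "w1 = 0"
proof -
  have cube: "\<omega> ^ 3 = 1" using \<omega> by Groebner_Basis.algebra
  have "(w1 + w2 + w3) * (x + y + z) = 0"
    using assms(1-3) by Groebner_Basis.algebra
  moreover have "(w1 + \<omega>\<^sup>2 * w2 + \<omega> * w3) * (x + \<omega> * y + \<omega>\<^sup>2 * z) = 0"
    using assms(1-3) cube by Groebner_Basis.algebra
  moreover have "(w1 + \<omega> * w2 + \<omega>\<^sup>2 * w3) * (x + \<omega>\<^sup>2 * y + \<omega> * z) = 0"
    using assms(1-3) cube by Groebner_Basis.algebra
  ultimately have "w1 + w2 + w3 = 0" "w1 + \<omega>\<^sup>2 * w2 + \<omega> * w3 = 0" "w1 + \<omega> * w2 + \<omega>\<^sup>2 * w3 = 0"
    using nonzero by auto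
  then have "3 * w1 = 0" using \<omega> by Groebner_Basis.algebra
  then show ?thesis by simp
qed

text \<open>Places finitely many roots of unity in one cyclotomic field. \<open>N\<close> is a
  product of exponents that kill the elements of \<open>S\<close>, and \<zeta> is a primitive root
  of unity of order \<open>N\<close>.\<close>

lemma roots_of_unity_common_generator:
  assumes "finite S" "\<And>\<xi>. \<xi> \<in> S \<Longrightarrow> root_of_unity \<xi>"
  obtains N and \<zeta> :: complex
  where "N > 0" "\<zeta> ^ N = 1" "\<And>z. z ^ N = 1 \<Longrightarrow> \<exists>k. z = \<zeta> ^ k" "\<And>\<xi>. \<xi> \<in> S \<Longrightarrow> \<xi> ^ N = 1"
proof -
  obtain e where e: "\<And>\<xi>. \<xi> \<in> S \<Longrightarrow> e \<xi> > 0 \<and> \<xi> ^ e \<xi> = 1"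
    using assms(2) unfolding root_of_unity_def by metis
  define N where "N = (\<Prod>\<xi>\<in>S. e \<xi>)"
  define \<zeta> where "\<zeta> = cis (2 * pi / real N)"
  have N: "N > 0" using e by (auto simp: N_def intro!: prod_pos)
  show ?thesis
  proof
    show "\<zeta> ^ N = 1" using N by (simp add: \<zeta>_def Complex.DeMoivre)
    show "\<exists>k. z = \<zeta> ^ k" if "z ^ N = 1" for z
    proof -
      have "z \<in> (\<lambda>k. cis (2 * pi * real k / real N)) ` {..<N}"
        using that Complex.bij_betw_roots_unity[OF N] by (simp add: bij_betw_def)
      then show ?thesis by (auto simp: \<zeta>_def Complex.DeMoivre mult_ac)
    qed
    show "\<xi> ^ N = 1" if "\<xi> \<in> S" for \<xi>
    proof -
      have "e \<xi> dvd N" unfolding N_def using that assms(1) by (rule dvd_prodI[rotated])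
      then show ?thesis using e[OF that] by (auto simp: power_mult)
    qed
  qed (rule N)
qed

context irreducible_cubic
begin

lemma twisted_sum_zero:
  assumes irrational: "\<delta> \<notin> \<rat>"
    and unity: "root_of_unity w1" "root_of_unity w2" "root_of_unity w3"
    and no_cube_root: "\<not> (\<exists>\<omega>\<in>rat_adjoin {l1, l2, l3}. primitive_root_of_unity 3 \<omega>)"
    and not_equal: "\<not> (rat_eval f l1 = rat_eval f l2 \<and> rat_eval f l2 = rat_eval f l3)"
    and rel: "w1 * rat_eval f l1 + w2 * rat_eval f l2 + w3 * rat_eval f l3 = 0"
  shows "rat_eval f l1 + rat_eval f l2 + rat_eval f l3 = 0"
proof (rule ccontr)
  assume sum: "rat_eval f l1 + rat_eval f l2 + rat_eval f l3 \<noteq> 0"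
  obtain N and \<zeta> :: complex where N: "N > 0" "\<zeta> ^ N = 1" and powers: "\<And>z. z ^ N = 1 \<Longrightarrow> \<exists>k. z = \<zeta> ^ k"
    and w: "\<And>\<xi>. \<xi> \<in> {w1, w2, w3} \<Longrightarrow> \<xi> ^ N = 1"
    using roots_of_unity_common_generator[of "{w1, w2, w3}"] unity
    by (metis finite.emptyI finite_insert insertE singletonD)
  have "Polynomial.degree ([:0, 1:] ^ N :: rat poly) = N"
    by (simp add: degree_power_eq)
  then have "[:0, 1:] ^ N - 1 \<noteq> (0 :: rat poly)" using N(1) by auto
  moreover have "rat_eval ([:0, 1:] ^ N - 1) \<zeta> = 0" using N(2) by simp
  ultimately obtain m where m: "Factorial_Ring.irreducible m" "rat_eval m \<zeta> = 0"
    and dvd: "m dvd [:0, 1:] ^ N - 1"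
    by (rule irreducible_factor_vanishing)
  have m_powers: "\<exists>k. z = \<zeta> ^ k" if z: "rat_eval m z = 0" for z
  proof -
    from irreducible_dvd_iff[OF m(1) z] dvd have "rat_eval ([:0, 1:] ^ N - 1) z = 0" by blast
    then have "z ^ N = 1" by simp
    then show ?thesis by (rule powers)
  qed
  define F where "F = range (\<lambda>h. rat_eval h \<zeta>)"
  have F: "complex_subfield F"
    unfolding F_def by (rule complex_subfield_range_rat_eval[OF m])
  interpret F: complex_subfield F by (rule F)
  interpret r: irreducible_cubic a b c l2 l3 l1 by (rule rotate)
  interpret r': irreducible_cubic a b c l3 l1 l2 by (rule r.rotate)
  have no_root_F: "l1 \<notin> F" "l2 \<notin> F" "l3 \<notin> F"
    using root_not_cyclotomic[OF m m_powers] r.root_not_cyclotomic[OF m m_powers]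
      r'.root_not_cyclotomic[OF m m_powers] irrational
    unfolding F_def r.delta_rotate delta_rotate by blast+
  define E where "E = {u + v * \<delta> |u v. u \<in> F \<and> v \<in> F}"
  have \<delta>2: "\<delta> * \<delta> \<in> F" by (rule F.Rats[OF delta_square_rational])
  have E: "complex_subfield E"
    unfolding E_def using F \<delta>2 by (rule complex_subfield_adjoin_sqrt)
  have FE: "u + v * \<delta> \<in> E" if "u \<in> F" "v \<in> F" for u v
    using that unfolding E_def by blast
  have \<delta>E: "\<delta> \<in> E" using FE[OF F.zero F.one] by simp
  have "rat_eval p x \<noteq> 0" if "x \<in> E" for x
    using that root_not_in_quadratic_extension[OF F \<delta>2 no_root_F] by (auto simp: E_def simp del: rat_eval_pCons)
  then have no_root_E: "l1 \<notin> E" "l2 \<notin> E" "l3 \<notin> E"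
    unfolding root_iff by blast+
  have wE: "\<xi> \<in> E" if \<xi>: "\<xi> \<in> {w1, w2, w3}" for \<xi>
  proof -
    obtain k where "\<xi> = rat_eval ([:0, 1:] ^ k) \<zeta>"
      using powers[OF w[OF \<xi>]] by auto
    then have "\<xi> \<in> F" unfolding F_def by (rule range_eqI)
    then show ?thesis using FE[OF _ F.zero] by simp
  qed
  have w123: "w1 \<in> E" "w2 \<in> E" "w3 \<in> E" by (simp_all add: wE)
  note rot = relation_rotate[OF E \<delta>E no_root_E w123 rel]

  interpret K: complex_subfield "rat_adjoin {l1, l2, l3}" by (rule complex_subfield_rat_adjoin)
  have K: "rat_eval f l1 \<in> rat_adjoin {l1, l2, l3}" "rat_eval f l2 \<in> rat_adjoin {l1, l2, l3}"
    "rat_eval f l3 \<in> rat_adjoin {l1, l2, l3}"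
    using rat_adjoin_incl[of "{l1, l2, l3}"] by (auto intro!: K.rat_eval)
  \<comment> \<open>Eliminating the square of \<omega> leaves a linear equation for \<omega> over
    the splitting field. Either it expresses \<omega> as an element of that field, or it forces
    \<open>x = y = z\<close>.\<close>
  have nz: "x + \<omega> * y + \<omega>\<^sup>2 * z \<noteq> 0"
    if \<omega>: "\<omega>\<^sup>2 + \<omega> + 1 = 0" and xyz: "x \<in> rat_adjoin {l1, l2, l3}" "y \<in> rat_adjoin {l1, l2, l3}"
      "z \<in> rat_adjoin {l1, l2, l3}" "\<not> (x = y \<and> y = z)" for x y z \<omega>
  proof
    assume "x + \<omega> * y + \<omega>\<^sup>2 * z = 0"
    then have eq: "(x - z) + \<omega> * (y - z) = 0" using \<omega> by Groebner_Basis.algebra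
    have "y \<noteq> z" using eq xyz(4) by auto
    with eq have "\<omega> = (x - z) / (z - y)" by (simp add: field_simps)
    then have "\<omega> \<in> rat_adjoin {l1, l2, l3}" using xyz K.divide K.diff by metis
    then show False using no_cube_root primitive_cube_root[OF \<omega>] by blast
  qed
  define \<omega> where "\<omega> = Complex (- 1 / 2) (sqrt 3 / 2)"
  have \<omega>: "\<omega>\<^sup>2 + \<omega> + 1 = 0"
    by (simp add: \<omega>_def complex_eq_iff power2_eq_square)
  \<comment> \<open>The remaining circulant factor is the previous one with the values at
    \<open>l2\<close> and \<open>l3\<close> exchanged.\<close>
  have "\<not> (rat_eval f l1 = rat_eval f l3 \<and> rat_eval f l3 = rat_eval f l2)"
    using not_equal by auto
  from nz[OF \<omega> K(1,3,2) this]
  have "rat_eval f l1 + \<omega>\<^sup>2 * rat_eval f l2 + \<omega> * rat_eval f l3 \<noteq> 0"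
    by (simp add: add_ac)
  then have "w1 = 0"
    by (rule circulant_kernel[OF rel rot \<omega> sum nz[OF \<omega> K not_equal]])
  then show False using unity(1) by (auto simp: root_of_unity_def power_0_left)
qed

text \<open>For negative \<open>n\<close> the Bezout inverse of X modulo the cubic is used, so that
  one polynomial represents the power at all three roots.\<close>

lemma root_power_int:
  obtains g where "\<And>z. rat_eval p z = 0 \<Longrightarrow> rat_eval g z = z powi n"
proof -
  have "\<not> p dvd [:0, 1:]" by (auto dest!: dvd_imp_degree_le)
  then obtain s where s: "\<And>z. rat_eval p z = 0 \<Longrightarrow> rat_eval s z * rat_eval [:0, 1:] z = 1"
    using irreducible_bezout[OF irred] by metis
  have inv: "rat_eval s z = inverse z" if "rat_eval p z = 0" for z
    using s[OF that] inverse_unique[of z "rat_eval s z"] by (simp add: mult.commute)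
  show ?thesis
  proof (cases "n \<ge> 0")
    case True
    then show ?thesis
      by (intro that[of "[:0, 1:] ^ nat n"]) (simp add: power_int_def)
  next
    case False
    then show ?thesis
      by (intro that[of "s ^ nat (- n)"]) (simp add: inv power_int_def del: rat_eval_pCons)
  qed
qed

end

section \<open>From the terms of the recurrence to conjugate values of one polynomial\<close>

lemma sum_1_3:
  fixes f :: "nat \<Rightarrow> 'a :: comm_monoid_add"
  shows "(\<Sum>k=1..3. f k) = f 1 + f 2 + f 3"
proof -
  have "{1..3} = {1, 2, 3 :: nat}" by auto
  then show ?thesis by (simp add: add.assoc)
qed

text \<open>Equal terms would make the quotient of logarithms equal to the integer
  \<open>n\<close>.\<close>

lemma log_quotient_imp_terms_neq:
  assumes log_cond: "ln (cmod ((q1 * d2) / (q2 * d1))) / ln (cmod (r2 / r1)) \<notin> \<int>"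
    and nz: "d1 \<noteq> 0" "d2 \<noteq> 0" "r1 \<noteq> 0" "r2 \<noteq> 0"
  shows "q1 / d1 * r1 powi n \<noteq> q2 / d2 * r2 powi n"
proof
  assume eq: "q1 / d1 * r1 powi n = q2 / d2 * r2 powi n"
  \<comment> \<open>Degenerate cases give the quotient 0, an integer, by the conventions that
    \<open>ln 0\<close> and division by zero are 0; the same applies to the logarithm in the
    denominator.\<close>
  have q: "q1 \<noteq> 0" "q2 \<noteq> 0" using log_cond by auto
  have l: "ln (cmod (r2 / r1)) \<noteq> 0" using log_cond by auto
  have "(q1 * d2) / (q2 * d1) = (r2 / r1) powi n"
    using eq nz q by (simp add: power_int_divide_distrib field_simps)
  then have "ln (cmod ((q1 * d2) / (q2 * d1))) = ln (cmod (r2 / r1) powi n)"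
    by (simp add: norm_power_int)
  also have "\<dots> = of_int n * ln (cmod (r2 / r1))"
    using nz by (simp flip: powr_real_of_int' add: ln_powr)
  finally show False using log_cond l by simp
qed

theorem theorem1p5:
  fixes a b c x0 x1 x2 :: int
    and x :: "int \<Rightarrow> complex"
    and lam C :: "nat \<Rightarrow> complex"
    and P q :: "complex poly"
    and i j :: nat
  assumes P: "P = map_poly of_int (rec_P a b c)"
    and q: "q = map_poly of_int (rec_q a b x0 x1 x2)"
    and roots: "P = (\<Prod>k=1..3. [:- lam k, 1:])"
    and init: "x 0 = of_int x0" "x 1 = of_int x1" "x 2 = of_int x2"
    and recurrence:
      "\<And>n. x n = of_int a * x (n - 1) + of_int b * x (n - 2) + of_int c * x (n - 3)"
    and coeffs: "\<And>k. k \<in> {1..3} \<Longrightarrow> C k = poly q (lam k) / poly (pderiv P) (lam k)"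
    and closed_form: "\<And>n. x n = (\<Sum>k=1..3. C k * lam k powi n)"
    and irred: "Factorial_Ring.irreducible (map_poly rat_of_int (rec_P a b c))"
    and i: "i \<in> {1..3}"
    and not_galois: "\<not> galois_extension complex_field \<rat> (rat_adjoin {lam i})"
    and j: "j \<in> {1..3}" "j \<noteq> i"
    and log_cond:
      "ln (cmod ((poly q (lam i) * poly (pderiv P) (lam j)) /
                 (poly q (lam j) * poly (pderiv P) (lam i))))
         / ln (cmod (lam j / lam i)) \<notin> \<int>"
    and no_cubic_root:
      "\<not> (\<exists>\<omega>\<in>rat_adjoin {lam 1, lam 2, lam 3}. primitive_root_of_unity 3 \<omega>)"
  shows "twisted_integral_zeros C lam = integral_zeros C lam"
proof -
  have set3: "{1..3} = {1, 2, 3 :: nat}" by auto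
  let ?p = "[:- rat_of_int c, - rat_of_int b, - rat_of_int a, 1:]"
  have p: "map_poly rat_of_int (rec_P a b c) = ?p"
    by (simp add: rec_P_def map_poly_pCons)
  have P': "P = map_poly of_rat ?p"
    by (simp add: P rec_P_def map_poly_pCons of_rat_minus)
  interpret L: irreducible_cubic "rat_of_int a" "rat_of_int b" "rat_of_int c" "lam 1" "lam 2" "lam 3"
  proof
    show "Factorial_Ring.irreducible ?p" using irred unfolding p .
    show "map_poly of_rat ?p = [:- lam 1, 1:] * [:- lam 2, 1:] * [:- lam 3, 1:]"
      unfolding P'[symmetric] roots set3 by (simp add: mult.assoc del: mult_pCons_left mult_pCons_right)
  qed
  interpret L2: irreducible_cubic "rat_of_int a" "rat_of_int b" "rat_of_int c" "lam 2" "lam 3" "lam 1"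
    by (rule L.rotate)
  interpret L3: irreducible_cubic "rat_of_int a" "rat_of_int b" "rat_of_int c" "lam 3" "lam 1" "lam 2"
    by (rule L2.rotate)
  \<comment> \<open>Each of the three rotations puts a different root first, so the criterion
    applies whichever root \<open>lam i\<close> is.\<close>
  have irrational: "L.\<delta> \<notin> \<rat>"
    using not_galois i L.delta_rational_imp_galois L2.delta_rational_imp_galois
      L3.delta_rational_imp_galois
    unfolding L.delta_rotate L2.delta_rotate set3 by auto
  have root: "rat_eval ?p (lam k) = 0" if "k \<in> {1..3}" for k
    using that unfolding L.root_iff set3 by auto
  have pd: "poly (pderiv P) z = rat_eval (pderiv ?p) z" for z
    by (simp add: P' pderiv_pCons rat_eval_def map_poly_pCons of_rat_minus of_rat_add of_rat_mult)
  obtain s where s: "\<And>z. rat_eval ?p z = 0 \<Longrightarrow> rat_eval s z * rat_eval (pderiv ?p) z = 1"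
    using L.pderiv_inverse by blast
  define Q where "Q = map_poly rat_of_int (rec_q a b x0 x1 x2)"
  have Q: "poly q z = rat_eval Q z" for z
    by (simp add: q Q_def rec_q_def rat_eval_def map_poly_pCons of_rat_diff of_rat_mult)
  have pd_nz: "poly (pderiv P) (lam k) \<noteq> 0" if "k \<in> {1..3}" for k
    using s[OF root[OF that]] unfolding pd by auto
  have lam_nz: "lam k \<noteq> 0" if "k \<in> {1..3}" for k
    using L.root_irrational[OF root[OF that]] by auto
  have "(\<Sum>k=1..3. C k * lam k powi n) = 0"
    if w: "\<forall>k\<in>{1..3}. root_of_unity (w k)" and rel: "(\<Sum>k=1..3. w k * C k * lam k powi n) = 0" for w n
  proof -
    obtain g where g: "\<And>z. rat_eval ?p z = 0 \<Longrightarrow> rat_eval g z = z powi n"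
      using L.root_power_int by blast
    \<comment> \<open>Here \<open>s\<close> represents the reciprocal of the derivative of the
      cubic, so \<open>Q * s\<close> represents the coefficients \<open>C k\<close> and
      \<open>f\<close> the terms of the sum.\<close>
    define f where "f = Q * s * g"
    have f: "rat_eval f (lam k) = C k * lam k powi n" if k: "k \<in> {1..3}" for k
      using s[OF root[OF k]] pd_nz[OF k]
      by (simp add: f_def coeffs[OF k] Q g[OF root[OF k]] pd field_simps del: rat_eval_pCons)
    have "C i * lam i powi n \<noteq> C j * lam j powi n"
      unfolding coeffs[OF i] coeffs[OF j(1)]
      by (rule log_quotient_imp_terms_neq[OF log_cond]) (use i j pd_nz lam_nz in auto)
    then have "\<not> (rat_eval f (lam 1) = rat_eval f (lam 2) \<and> rat_eval f (lam 2) = rat_eval f (lam 3))"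
      using i j(1) f[OF i] f[OF j(1)] unfolding set3 by auto
    moreover have "w 1 * rat_eval f (lam 1) + w 2 * rat_eval f (lam 2) + w 3 * rat_eval f (lam 3) = 0"
      using rel unfolding sum_1_3 by (simp add: f mult.assoc)
    ultimately have "rat_eval f (lam 1) + rat_eval f (lam 2) + rat_eval f (lam 3) = 0"
      by (intro L.twisted_sum_zero[OF irrational _ _ _ no_cubic_root, of "w 1" "w 2" "w 3"])
        (use w in auto)
    then show ?thesis unfolding sum_1_3 by (simp add: f)
  qed
  then have "twisted_integral_zeros C lam \<subseteq> integral_zeros C lam"
    unfolding twisted_integral_zeros_def integral_zeros_def by blast
  moreover have "root_of_unity 1" by (auto simp: root_of_unity_def)
  then have "n \<in> twisted_integral_zeros C lam" if "n \<in> integral_zeros C lam" for n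
    using that unfolding twisted_integral_zeros_def integral_zeros_def
    by (intro CollectI exI[of _ "\<lambda>_. 1"]) simp
  ultimately show ?thesis by blast
qed

end
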